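(* Let $n, k \in \mathbb N$ and let $p_1,\dots,p_k \in M_n(\mathbb C) \ast_{\mathbb C} \mathbb C\langle x_1,\dots,x_k \rangle$ be self-adjoint free matrix polynomials in $k$ variables, each of odd degree (the degrees may differ). If the $k$-tuple of leading forms of $p_1,\dots,p_k$ is non-degenerate, then there exist self-adjoint matrices $X_1,\dots,X_k \in M_n(\mathbb C)_h$ such that $p_i(X_1,\dots,X_k)=0$ for all $1 \leq i \leq k$.
   Context: Fix $n \in \mathbb N$. $M_n(\mathbb C)$ is the algebra of complex $(n\times n)$-matrices and $M_n(\mathbb C)_h$ is the set of self-adjoint (Hermitian) matrices in it. $\mathbb C\langle x_1,\dots,x_k\rangle$ is the free unital $\mathbb C$-algebra on $x_1,\dots,x_k$. A free matrix polynomial in $k$ variables is an element of the unital ring $M_n(\mathbb C) \ast_{\mathbb C} \mathbb C\langle x_1,\dots,x_k \rangle$ (free product amalgamated over $\mathbb C$). Its elements are linear combinations of monomials $A_0 x_{i_1} A_1 x_{i_2} \cdots x_{i_d} A_d$ with $i_l \in \{1,\dots,k\}$ and $A_0,\dots,A_d \in M_n(\mathbb C)$. The ring is graded, such a monomial being homogeneous of degree $d$. The degree of a non-zero element is the largest $d$ for which its component in degree $d$ is non-zero, and its leading form is that component; the degree is that of the ring element and need not be the degree of the associated polynomial map. The adjoint is the conjugate-linear involution given on monomials by $(A_0 x_{i_1} A_1 \cdots x_{i_d} A_d)^* = A_d^* x_{i_d} \cdots A_1^* x_{i_1} A_0^*$; $p$ is self-adjoint if $p^*=p$. Evaluation $p(X_1,\dots,X_k)$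 at matrices $X_1,\dots,X_k\in M_n(\mathbb C)$ is by substituting $X_i$ for $x_i$. A $k$-tuple of homogeneous self-adjoint free matrix polynomials $q_1,\dots,q_k$ is non-degenerate if for all $X_1,\dots,X_k \in M_n(\mathbb C)_h$: whenever $q_i(X_1,\dots,X_k)=0$ for all $1\le i\le k$, then $X_i=0$ for all $1 \le i \le k$. *)

theory Defs
  imports "HOL-Analysis.Analysis" "HOL-Computational_Algebra.Formal_Power_Series"
begin

section \<open>Self-adjoint matrices\<close>

definition ctranspose :: "complex^'n^'m \<Rightarrow> complex^'m^'n"
  where "ctranspose A = (\<chi> i j. cnj (A $ j $ i))"

definition hermitian :: "complex^'n^'n \<Rightarrow> bool"
  where "hermitian A \<longleftrightarrow> ctranspose A = A"

lemma ctranspose_add: "ctranspose (A + B) = ctranspose A + ctranspose B"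
  by (simp add: ctranspose_def vec_eq_iff)

lemma ctranspose_mult: "ctranspose (A ** B) = ctranspose B ** ctranspose A"
  by (simp add: ctranspose_def vec_eq_iff matrix_matrix_mult_def mult.commute)

lemma ctranspose_mat: "ctranspose (mat c) = mat (cnj c)"
  by (simp add: ctranspose_def vec_eq_iff mat_def)

lemma ctranspose_0: "ctranspose 0 = 0"
  by (simp add: ctranspose_def vec_eq_iff)

lemma ctranspose_minus: "ctranspose (- A) = - ctranspose A"
  by (simp add: ctranspose_def vec_eq_iff)

lemma ctranspose_ctranspose: "ctranspose (ctranspose A) = A"
  by (simp add: ctranspose_def vec_eq_iff)


lemma mat_scalar_commute:
  fixes A :: "complex^'n^'n"
  shows "mat c ** A = A ** mat c"
  by (simp add: vec_eq_iff matrix_matrix_mult_def mat_def if_distrib if_distribR mult.commute cong: if_cong)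

lemma matrix_minus_one: "- mat 1 ** (A :: complex^'n^'n) = - A"
  by (simp add: vec_eq_iff matrix_matrix_mult_def mat_def if_distrib if_distribR cong: if_cong)

lemma matrix_mult_add_distrib_right: "(A + B) ** (C :: complex^'n^'n) = A ** C + B ** C"
  by (simp add: vec_eq_iff matrix_matrix_mult_def distrib_right sum.distrib)

lemma mat_plus: "mat (a + b) = (mat a + mat b :: complex^'n^'n)"
  by (simp add: vec_eq_iff mat_def)

lemma mat_times: "mat (a * b) = (mat a ** mat b :: complex^'n^'n)"
proof -
  have "(\<Sum>k\<in>UNIV. (if i = k then a else 0) * (if k = j then b else 0)) = (if i = j then a * b else 0)" for i j :: 'n
    by (subst sum.remove[of _ i]) (auto intro: sum.neutral)
  then show ?thesis by (simp add: vec_eq_iff matrix_matrix_mult_def mat_def)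
qed


section \<open>The ring of free matrix polynomials\<close>

text \<open>
  The amalgamated free product of the matrix algebra and the free algebra on the variables,
  given by generators and relations: ring expressions in the matrices and the variables, modulo
  the least congruence that enforces the axioms of a unital ring, makes \<open>Coef\<close> a unital ring
  homomorphism, and makes the scalar matrices commute with the variables (so that they act as
  the common copy of the complex numbers). The universal property is proved below.
  (\<open>**\<close> is the matrix product; \<open>mat c\<close> is the scalar matrix \<open>c I\<close>.)
\<close>

datatype ('n::finite, 'k) fmexp =
    Coef "complex^'n^'n"
  | Var 'k
  | Add "('n, 'k) fmexp" "('n, 'k) fmexp"
  | Mul "('n, 'k) fmexp" "('n, 'k) fmexp"

inductive fmeq :: "('n::finite, 'k) fmexp \<Rightarrow> ('n, 'k) fmexp \<Rightarrow> bool" where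
  fm_refl: "fmeq a a"
| fm_sym: "fmeq a b \<Longrightarrow> fmeq b a"
| fm_trans: "fmeq a b \<Longrightarrow> fmeq b c \<Longrightarrow> fmeq a c"
| fm_Add_cong: "fmeq a a' \<Longrightarrow> fmeq b b' \<Longrightarrow> fmeq (Add a b) (Add a' b')"
| fm_Mul_cong: "fmeq a a' \<Longrightarrow> fmeq b b' \<Longrightarrow> fmeq (Mul a b) (Mul a' b')"
| fm_Add_assoc: "fmeq (Add (Add a b) c) (Add a (Add b c))"
| fm_Add_comm: "fmeq (Add a b) (Add b a)"
| fm_Add_zero: "fmeq (Add (Coef 0) a) a"
| fm_Add_neg: "fmeq (Add (Mul (Coef (- mat 1)) a) a) (Coef 0)"
| fm_Mul_assoc: "fmeq (Mul (Mul a b) c) (Mul a (Mul b c))"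
| fm_Mul_one_left: "fmeq (Mul (Coef (mat 1)) a) a"
| fm_Mul_one_right: "fmeq (Mul a (Coef (mat 1))) a"
| fm_distrib_right: "fmeq (Mul (Add a b) c) (Add (Mul a c) (Mul b c))"
| fm_distrib_left: "fmeq (Mul a (Add b c)) (Add (Mul a b) (Mul a c))"
| fm_Coef_add: "fmeq (Coef (A + B)) (Add (Coef A) (Coef B))"
| fm_Coef_mult: "fmeq (Coef (A ** B)) (Mul (Coef A) (Coef B))"
| fm_Coef_scalar: "fmeq (Mul (Coef (mat c)) (Var i)) (Mul (Var i) (Coef (mat c)))"

quotient_type ('n, 'k) fmpoly = "('n::finite, 'k) fmexp" / fmeq
  by (auto intro!: equivpI reflpI sympI transpI intro: fmeq.fm_refl fmeq.fm_sym fmeq.fm_trans)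

primrec fmexp_eval :: "('k \<Rightarrow> complex^'n^'n) \<Rightarrow> ('n::finite, 'k) fmexp \<Rightarrow> complex^'n^'n" where
  "fmexp_eval X (Coef A) = A"
| "fmexp_eval X (Var i) = X i"
| "fmexp_eval X (Add a b) = fmexp_eval X a + fmexp_eval X b"
| "fmexp_eval X (Mul a b) = fmexp_eval X a ** fmexp_eval X b"

lemma fmexp_eval_cong: "fmeq a b \<Longrightarrow> fmexp_eval X a = fmexp_eval X b"
  by (induction rule: fmeq.induct)
    (simp_all add: matrix_mul_assoc matrix_add_ldistrib matrix_mult_add_distrib_right
      mat_scalar_commute matrix_minus_one add.assoc add.commute)

instantiation fmpoly :: (finite, type) ring_1
begin

lift_definition zero_fmpoly :: "('a, 'b) fmpoly" is "Coef 0" .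
lift_definition one_fmpoly :: "('a, 'b) fmpoly" is "Coef (mat 1)" .
lift_definition plus_fmpoly :: "('a, 'b) fmpoly \<Rightarrow> ('a, 'b) fmpoly \<Rightarrow> ('a, 'b) fmpoly"
  is Add by (rule fmeq.fm_Add_cong)
lift_definition times_fmpoly :: "('a, 'b) fmpoly \<Rightarrow> ('a, 'b) fmpoly \<Rightarrow> ('a, 'b) fmpoly"
  is Mul by (rule fmeq.fm_Mul_cong)
lift_definition uminus_fmpoly :: "('a, 'b) fmpoly \<Rightarrow> ('a, 'b) fmpoly"
  is "Mul (Coef (- mat 1))" by (intro fmeq.fm_Mul_cong fmeq.fm_refl)
definition minus_fmpoly :: "('a, 'b) fmpoly \<Rightarrow> ('a, 'b) fmpoly \<Rightarrow> ('a, 'b) fmpoly"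
  where "minus_fmpoly a b = a + - b"

instance
proof
  fix a b c :: "('a, 'b) fmpoly"
  show "a + b + c = a + (b + c)" by transfer (rule fmeq.fm_Add_assoc)
  show "a + b = b + a" by transfer (rule fmeq.fm_Add_comm)
  show "0 + a = a" by transfer (rule fmeq.fm_Add_zero)
  show "- a + a = 0" by transfer (rule fmeq.fm_Add_neg)
  show "a - b = a + - b" by (rule minus_fmpoly_def)
  show "a * b * c = a * (b * c)" by transfer (rule fmeq.fm_Mul_assoc)
  show "1 * a = a" by transfer (rule fmeq.fm_Mul_one_left)
  show "a * 1 = a" by transfer (rule fmeq.fm_Mul_one_right)
  show "(a + b) * c = a * c + b * c" by transfer (rule fmeq.fm_distrib_right)
  show "a * (b + c) = a * b + a * c" by transfer (rule fmeq.fm_distrib_left)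
  show "(0 :: ('a, 'b) fmpoly) \<noteq> 1"
  proof transfer
    have "(mat 1 :: complex^'a^'a) $ i $ i \<noteq> 0 $ i $ i" for i by (simp add: mat_def)
    then have "(0 :: complex^'a^'a) \<noteq> mat 1" by metis
    then show "\<not> fmeq (Coef 0) (Coef (mat 1) :: ('a, 'b) fmexp)"
      using fmexp_eval_cong[of "Coef 0" "Coef (mat 1) :: ('a, 'b) fmexp"] by auto
  qed
qed

end

lift_definition coef :: "complex^'n^'n \<Rightarrow> ('n::finite, 'k) fmpoly" is Coef .
lift_definition var :: "'k \<Rightarrow> ('n::finite, 'k) fmpoly" is Var .

lemma coef_add: "coef (A + B) = coef A + coef B"
  by transfer (rule fmeq.fm_Coef_add)

lemma coef_mult: "coef (A ** B) = coef A * coef B"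
  by transfer (rule fmeq.fm_Coef_mult)

lemma coef_one: "coef (mat 1) = 1"
  by transfer (rule fmeq.fm_refl)

lemma coef_zero: "coef 0 = 0"
  by transfer (rule fmeq.fm_refl)

lemma coef_minus: "coef (- A) = - coef A"
  by (metis coef_add coef_zero add.right_inverse minus_unique)

lemma fmpoly_induct [case_names coef var add mult]:
  assumes "\<And>A. P (coef A)" and "\<And>i. P (var i)"
    and "\<And>a b. P a \<Longrightarrow> P b \<Longrightarrow> P (a + b)" and "\<And>a b. P a \<Longrightarrow> P b \<Longrightarrow> P (a * b)"
  shows "P (p :: ('n::finite, 'k) fmpoly)"
proof -
  have "P (abs_fmpoly e)" for e :: "('n, 'k) fmexp"
  proof (induction e)
    case (Coef A) then show ?case using assms(1)[of A] by (simp add: coef.abs_eq)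
  next
    case (Var i) then show ?case using assms(2)[of i] by (simp add: var.abs_eq)
  next
    case (Add a b) then show ?case using assms(3) by (metis plus_fmpoly.abs_eq)
  next
    case (Mul a b) then show ?case using assms(4) by (metis times_fmpoly.abs_eq)
  qed
  then show ?thesis by (metis Quotient_abs_rep[OF Quotient_fmpoly])
qed

lemma coef_mat_commute: "coef (mat c) * p = p * coef (mat c)"
proof (induction p rule: fmpoly_induct)
  case (coef A)
  then show ?case by (simp add: mat_scalar_commute flip: coef_mult)
next
  case (var i)
  then show ?case by transfer (rule fmeq.fm_Coef_scalar)
next
  case (add a b)
  then show ?case by (simp add: algebra_simps)
next
  case (mult a b)
  then show ?case by (metis mult.assoc)
qed

primrec fmexp_lift :: "(complex^'n^'n \<Rightarrow> 'r) \<Rightarrow> ('k \<Rightarrow> 'r) \<Rightarrow> ('n::finite, 'k) fmexp \<Rightarrow> 'r::ring_1"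
  where
    "fmexp_lift \<phi> y (Coef A) = \<phi> A"
  | "fmexp_lift \<phi> y (Var i) = y i"
  | "fmexp_lift \<phi> y (Add a b) = fmexp_lift \<phi> y a + fmexp_lift \<phi> y b"
  | "fmexp_lift \<phi> y (Mul a b) = fmexp_lift \<phi> y a * fmexp_lift \<phi> y b"

theorem fmpoly_universal:
  fixes \<phi> :: "complex^'n^'n \<Rightarrow> 'r::ring_1" and y :: "'k \<Rightarrow> 'r"
  assumes add: "\<And>A B. \<phi> (A + B) = \<phi> A + \<phi> B"
    and mult: "\<And>A B. \<phi> (A ** B) = \<phi> A * \<phi> B"
    and one: "\<phi> (mat 1) = 1"
    and scalar: "\<And>c i. \<phi> (mat c) * y i = y i * \<phi> (mat c)"
  shows "\<exists>!h :: ('n::finite, 'k) fmpoly \<Rightarrow> 'r.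
    (\<forall>p q. h (p + q) = h p + h q) \<and> (\<forall>p q. h (p * q) = h p * h q) \<and> h 1 = 1 \<and>
    (\<forall>A. h (coef A) = \<phi> A) \<and> (\<forall>i. h (var i) = y i)"
proof -
  have zero: "\<phi> 0 = 0" using add[of 0 0] by simp
  have neg: "\<phi> (- A) = - \<phi> A" for A
    using add[of "- A" A] zero by (simp add: eq_neg_iff_add_eq_0)
  have resp: "fmexp_lift \<phi> y a = fmexp_lift \<phi> y b" if "fmeq a b" for a b
    using that by induction (simp_all add: add mult one scalar zero neg algebra_simps)
  define h :: "('n, 'k) fmpoly \<Rightarrow> 'r" where "h = (\<lambda>p. fmexp_lift \<phi> y (rep_fmpoly p))"
  have abs: "h (abs_fmpoly e) = fmexp_lift \<phi> y e" for e
    unfolding h_def by (rule resp) (metis Quotient_fmpoly Quotient_rep_abs fmeq.fm_refl)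
  have ex: "\<exists>e. p = abs_fmpoly e" for p :: "('n, 'k) fmpoly"
    by (metis Quotient_abs_rep[OF Quotient_fmpoly])
  show ?thesis
  proof (rule ex1I[where a = h], intro conjI allI)
    fix p q show "h (p + q) = h p + h q"
      using ex[of p] ex[of q] by (auto simp: plus_fmpoly.abs_eq abs)
  next
    fix p q show "h (p * q) = h p * h q"
      using ex[of p] ex[of q] by (auto simp: times_fmpoly.abs_eq abs)
  next
    fix g :: "('n, 'k) fmpoly \<Rightarrow> 'r"
    assume g: "(\<forall>p q. g (p + q) = g p + g q) \<and> (\<forall>p q. g (p * q) = g p * g q) \<and> g 1 = 1 \<and>
      (\<forall>A. g (coef A) = \<phi> A) \<and> (\<forall>i. g (var i) = y i)"
    have "g (abs_fmpoly e) = fmexp_lift \<phi> y e" for e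
      by (induction e) (use g in \<open>simp_all flip: coef.abs_eq var.abs_eq plus_fmpoly.abs_eq times_fmpoly.abs_eq\<close>)
    then show "g = h" using ex abs by (metis ext)
  qed (simp_all add: one_fmpoly.abs_eq coef.abs_eq var.abs_eq abs one)
qed


section \<open>Evaluation and adjoint\<close>

lift_definition eval :: "('k \<Rightarrow> complex^'n^'n) \<Rightarrow> ('n::finite, 'k) fmpoly \<Rightarrow> complex^'n^'n"
  is fmexp_eval
  by (rule fmexp_eval_cong)

lemma eval_coef: "eval X (coef A) = A"
  and eval_var: "eval X (var i) = X i"
  and eval_add: "eval X (p + q) = eval X p + eval X q"
  and eval_mult: "eval X (p * q) = eval X p ** eval X q"
  by (transfer; simp)+

primrec fmexp_adj :: "('n::finite, 'k) fmexp \<Rightarrow> ('n, 'k) fmexp" where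
  "fmexp_adj (Coef A) = Coef (ctranspose A)"
| "fmexp_adj (Var i) = Var i"
| "fmexp_adj (Add a b) = Add (fmexp_adj a) (fmexp_adj b)"
| "fmexp_adj (Mul a b) = Mul (fmexp_adj b) (fmexp_adj a)"

lift_definition adj :: "('n::finite, 'k) fmpoly \<Rightarrow> ('n, 'k) fmpoly" is fmexp_adj
proof -
  fix a b :: "('n, 'k) fmexp"
  assume "fmeq a b"
  then have "abs_fmpoly (fmexp_adj a) = abs_fmpoly (fmexp_adj b)"
  proof induction
    case (fm_Add_neg a)
    have "p * coef (- mat 1) + p = 0" for p :: "('n, 'k) fmpoly"
      by (simp add: coef_minus coef_one)
    then show ?case
      by (simp add: ctranspose_minus ctranspose_mat ctranspose_0 coef_zero
          flip: coef.abs_eq var.abs_eq plus_fmpoly.abs_eq times_fmpoly.abs_eq)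
  qed (simp_all add: ctranspose_add ctranspose_mult ctranspose_mat ctranspose_0
        coef_add coef_mult coef_one coef_zero coef_mat_commute algebra_simps
        flip: coef.abs_eq var.abs_eq plus_fmpoly.abs_eq times_fmpoly.abs_eq)
  then show "fmeq (fmexp_adj a) (fmexp_adj b)"
    by (simp add: fmpoly.abs_eq_iff)
qed

lemma adj_coef: "adj (coef A) = coef (ctranspose A)"
  by (simp add: coef.abs_eq adj.abs_eq)

lemma adj_var: "adj (var i) = var i"
  by (simp add: var.abs_eq adj.abs_eq)

lemma adj_add: "adj (p + q) = adj p + adj q"
proof transfer
  fix p q :: "('a, 'b) fmexp"
  show "fmeq (fmexp_adj (Add p q)) (Add (fmexp_adj p) (fmexp_adj q))"
    unfolding fmexp_adj.simps by (rule fmeq.fm_refl)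
qed

lemma adj_mult: "adj (p * q) = adj q * adj p"
proof transfer
  fix p q :: "('a, 'b) fmexp"
  show "fmeq (fmexp_adj (Mul p q)) (Mul (fmexp_adj q) (fmexp_adj p))"
    unfolding fmexp_adj.simps by (rule fmeq.fm_refl)
qed

definition self_adjoint :: "('n::finite, 'k) fmpoly \<Rightarrow> bool"
  where "self_adjoint p \<longleftrightarrow> adj p = p"


section \<open>Monomials, grading, degree and leading form\<close>

definition fm_scale :: "complex \<Rightarrow> ('n::finite, 'k) fmpoly \<Rightarrow> ('n, 'k) fmpoly"
  where "fm_scale c p = coef (mat c) * p"

interpretation fmpoly: vector_space "fm_scale :: complex \<Rightarrow> ('n::finite, 'k) fmpoly \<Rightarrow> _"
proof
  fix a b :: complex and x y :: "('n::finite, 'k) fmpoly"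
  show "fm_scale a (x + y) = fm_scale a x + fm_scale a y"
    by (simp add: fm_scale_def distrib_left)
  show "fm_scale (a + b) x = fm_scale a x + fm_scale b x"
    by (simp only: fm_scale_def mat_plus coef_add distrib_right)
  show "fm_scale a (fm_scale b x) = fm_scale (a * b) x"
    by (simp only: fm_scale_def mat_times coef_mult mult.assoc)
  show "fm_scale 1 x = x"
    by (simp only: fm_scale_def coef_one mult_1_left)
qed

text \<open>\<open>monomial A\<^sub>0 [(i\<^sub>1, A\<^sub>1), \<dots>, (i\<^sub>d, A\<^sub>d)]\<close> is the monomial
  \<open>A\<^sub>0 x\<^bsub>i\<^sub>1\<^esub> A\<^sub>1 \<dots> x\<^bsub>i\<^sub>d\<^esub> A\<^sub>d\<close>.\<close>

definition monomial :: "complex^'n^'n \<Rightarrow> ('k \<times> (complex^'n^'n)) list \<Rightarrow> ('n::finite, 'k) fmpoly"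
  where "monomial A w = coef A * prod_list (map (\<lambda>(i, B). var i * coef B) w)"

definition homogeneous :: "nat \<Rightarrow> ('n::finite, 'k) fmpoly set"
  where "homogeneous d = fmpoly.span {monomial A w | A w. length w = d}"

definition decomposes :: "('n::finite, 'k) fmpoly \<Rightarrow> (nat \<Rightarrow> ('n, 'k) fmpoly) \<Rightarrow> bool"
  where "decomposes p h \<longleftrightarrow>
    (\<forall>d. h d \<in> homogeneous d) \<and> finite {d. h d \<noteq> 0} \<and> p = (\<Sum>d | h d \<noteq> 0. h d)"

definition component :: "nat \<Rightarrow> ('n::finite, 'k) fmpoly \<Rightarrow> ('n, 'k) fmpoly"
  where "component d p = (THE h. decomposes p h) d"

text \<open>Only meaningful for \<open>p \<noteq> 0\<close>; otherwise the set below is empty.\<close>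

definition fm_degree :: "('n::finite, 'k) fmpoly \<Rightarrow> nat"
  where "fm_degree p = Max {d. component d p \<noteq> 0}"

definition leading_form :: "('n::finite, 'k) fmpoly \<Rightarrow> ('n, 'k) fmpoly"
  where "leading_form p = component (fm_degree p) p"

lemma adj_scale: "adj (fm_scale c p) = fm_scale (cnj c) (adj p)"
  by (simp only: fm_scale_def adj_mult adj_coef ctranspose_mat) (rule coef_mat_commute[symmetric])

lemma adj_adj: "adj (adj p) = p"
  by (induction p rule: fmpoly_induct) (simp_all add: adj_coef adj_var adj_add adj_mult ctranspose_ctranspose)

lemma monomial_coef_mult: "coef B * monomial A w = monomial (B ** A) w"
  by (simp add: monomial_def coef_mult mult.assoc)

lemma monomial_var_mult: "var i * monomial A w = monomial (mat 1) ((i, A) # w)"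
  by (simp add: monomial_def coef_one mult.assoc)

lemma monomial_snoc: "monomial A (w @ [(i, B)]) = monomial A w * var i * coef B"
  by (simp add: monomial_def mult.assoc)

lemma adj_monomial_Nil: "adj (monomial A []) = monomial (ctranspose A) []"
  by (simp add: monomial_def adj_coef)

lemma adj_monomial_snoc:
  "adj (monomial A (w @ [(i, B)])) = coef (ctranspose B) * var i * adj (monomial A w)"
  by (simp add: monomial_snoc adj_mult adj_var adj_coef mult.assoc)

lemma scale_monomial: "fm_scale c (monomial A w) = monomial (mat c ** A) w"
  by (simp add: fm_scale_def monomial_coef_mult)

lemma monomial_in_homogeneous: "monomial A w \<in> homogeneous (length w)"
  unfolding homogeneous_def by (rule fmpoly.span_base) blast

lemma adj_sum: "adj (sum f S) = (\<Sum>x\<in>S. adj (f x))"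
proof (cases "finite S")
  case True
  have "adj (0 :: ('a, 'b) fmpoly) = 0"
    using adj_coef[of 0] by (simp add: coef_zero ctranspose_0)
  with True show ?thesis by induction (simp_all add: adj_add)
next
  case False
  have "adj (0 :: ('a, 'b) fmpoly) = 0"
    using adj_coef[of 0] by (simp add: coef_zero ctranspose_0)
  with False show ?thesis by simp
qed

lemma span_monomials: "p \<in> fmpoly.span {monomial A w | A w. True}"
proof -
  let ?S = "fmpoly.span {monomial A w | A w. True} :: ('a, 'b) fmpoly set"
  have coef: "coef B * q \<in> ?S" if "q \<in> ?S" for B :: "complex^'a^'a" and q
    using that
  proof (induction rule: fmpoly.span_induct_alt)
    case base show ?case by (simp add: fmpoly.span_zero)
  next
    case (step c x y)
    then obtain A w where x: "x = monomial A w" by blast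
    have "coef B * (fm_scale c x + y) = monomial (B ** (mat c ** A)) w + coef B * y"
      by (simp add: x scale_monomial distrib_left monomial_coef_mult)
    moreover have "\<dots> \<in> ?S"
      using step by (intro fmpoly.span_add[OF fmpoly.span_base]) auto
    ultimately show ?case by simp
  qed
  have var: "var i * q \<in> ?S" if "q \<in> ?S" for i q
    using that
  proof (induction rule: fmpoly.span_induct_alt)
    case base show ?case by (simp add: fmpoly.span_zero)
  next
    case (step c x y)
    then obtain A w where x: "x = monomial A w" by blast
    have "var i * (fm_scale c x + y) = monomial (mat 1) ((i, mat c ** A) # w) + var i * y"
      by (simp add: x scale_monomial distrib_left monomial_var_mult)
    moreover have "\<dots> \<in> ?S"
      using step by (intro fmpoly.span_add[OF fmpoly.span_base]) auto
    ultimately show ?case by simp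
  qed
  have "\<forall>q\<in>?S. p * q \<in> ?S"
  proof (induction p rule: fmpoly_induct)
    case (add a b)
    then show ?case by (simp add: distrib_right fmpoly.span_add)
  next
    case (mult a b)
    then show ?case by (simp add: mult.assoc)
  qed (use coef var in auto)
  moreover have "1 \<in> ?S"
    by (rule fmpoly.span_base) (auto simp: monomial_def coef_one intro!: exI[of _ "mat 1"] exI[of _ "[]"])
  ultimately show ?thesis by force
qed

text \<open>Uniqueness of homogeneous components: the ring homomorphism to formal power series (in a
  central variable) with coefficients in the ring that fixes the matrices and multiplies every
  variable by the series variable reads off the components.\<close>

lemma grading_hom:
  obtains g :: "('n::finite, 'k) fmpoly \<Rightarrow> ('n, 'k) fmpoly fps"
  where "\<And>p q. g (p + q) = g p + g q"
    and "\<And>d p. p \<in> homogeneous d \<Longrightarrow> g p = fps_const p * fps_X ^ d"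
proof -
  have comm: "fps_X * f = f * fps_X" for f :: "('n, 'k) fmpoly fps"
    by (metis fps_mult_fps_X_commute)
  have pull: "fps_X * (fps_const q * f) = fps_const q * (fps_X * f)" for q :: "('n, 'k) fmpoly" and f
    by (metis comm mult.assoc)
  obtain g :: "('n, 'k) fmpoly \<Rightarrow> ('n, 'k) fmpoly fps"
    where add: "\<And>p q. g (p + q) = g p + g q" and mult: "\<And>p q. g (p * q) = g p * g q"
      and one: "g 1 = 1" and co: "\<And>A. g (coef A) = fps_const (coef A)"
      and va: "\<And>i. g (var i) = fps_const (var i) * fps_X"
  proof -
    have "fps_const (coef (mat c)) * (fps_const (var i) * fps_X) =
        fps_const (var i) * fps_X * fps_const (coef (mat c) :: ('n, 'k) fmpoly)" for c i
    proof -
      have "fps_const (coef (mat c)) * (fps_const (var i) * fps_X) =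
          fps_const (coef (mat c) * var i :: ('n, 'k) fmpoly) * fps_X"
        by (simp only: fps_const_mult mult.assoc[symmetric])
      also have "\<dots> = fps_const (var i * coef (mat c)) * fps_X"
        by (simp only: coef_mat_commute)
      also have "\<dots> = fps_const (var i) * fps_X * fps_const (coef (mat c))"
        by (metis comm fps_const_mult mult.assoc)
      finally show ?thesis .
    qed
    then have "\<exists>!h :: ('n, 'k) fmpoly \<Rightarrow> ('n, 'k) fmpoly fps.
      (\<forall>p q. h (p + q) = h p + h q) \<and> (\<forall>p q. h (p * q) = h p * h q) \<and> h 1 = 1 \<and>
      (\<forall>A. h (coef A) = fps_const (coef A)) \<and> (\<forall>i. h (var i) = fps_const (var i) * fps_X)"
      by (intro fmpoly_universal) (simp_all add: coef_add coef_mult coef_one)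
    then show ?thesis using that by blast
  qed
  have prod: "g (prod_list (map (\<lambda>(i, B). var i * coef B) w)) =
      fps_const (prod_list (map (\<lambda>(i, B). var i * coef B) w)) * fps_X ^ length w" for w
  proof (induction w)
    case Nil show ?case by (simp add: one)
  next
    case (Cons v w)
    obtain i B where v: "v = (i, B)" by (cases v)
    let ?r = "prod_list (map (\<lambda>(i, B). var i * coef B) w) :: ('n, 'k) fmpoly"
    have "g (var i * coef B * ?r) =
        fps_const (var i) * fps_X * fps_const (coef B) * (fps_const ?r * fps_X ^ length w)"
      by (simp only: mult co va Cons)
    also have "\<dots> = fps_const (var i) * fps_const (coef B) * fps_const ?r * (fps_X * fps_X ^ length w)"
      by (simp only: mult.assoc pull)
    finally show ?case by (simp add: v fps_const_mult[symmetric] del: fps_const_mult)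
  qed
  have mono: "g (monomial A w) = fps_const (monomial A w) * fps_X ^ length w" for A w
    unfolding monomial_def by (simp only: mult co prod fps_const_mult[symmetric] mult.assoc)
  have "g p = fps_const p * fps_X ^ d" if "p \<in> homogeneous d" for d p
    using that unfolding homogeneous_def
  proof (induction rule: fmpoly.span_induct_alt)
    case base
    have "g 0 = 0" using add[of 0 0] by simp
    then show ?case by simp
  next
    case (step c x y)
    then obtain A w where x: "x = monomial A w" and d: "length w = d" by blast
    show ?case unfolding add step x scale_monomial mono d
      by (simp add: distrib_right flip: fps_const_add)
  qed
  with add that show ?thesis by blast
qed

theorem decomposes_ex1:
  fixes p :: "('a::finite, 'b) fmpoly"
  shows "\<exists>!h. decomposes p h"
proof (rule ex_ex1I)
  define P where "P p \<longleftrightarrow> (\<exists>h N. (\<forall>d. h d \<in> homogeneous d) \<and> (\<forall>d\<ge>N. h d = 0) \<and> p = (\<Sum>d<N. h d))"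
    for p :: "('a, 'b) fmpoly"
  have "P p" using span_monomials[of p]
  proof (induction rule: fmpoly.span_induct_alt)
    case base
    show ?case unfolding P_def
      by (rule exI[of _ "\<lambda>_. 0"], rule exI[of _ 0]) (simp add: homogeneous_def fmpoly.span_zero)
  next
    case (step c x y)
    then obtain A w where x: "x = monomial A w" by blast
    from step obtain h N where h: "\<forall>d. h d \<in> homogeneous d" "\<forall>d\<ge>N. h d = 0" "y = (\<Sum>d<N. h d)"
      unfolding P_def by blast
    let ?M = "max N (Suc (length w))"
    let ?e = "\<lambda>d. if d = length w then fm_scale c x else 0"
    have "(\<Sum>d<?M. h d) = (\<Sum>d<N. h d)"
      using h(2) by (intro sum.mono_neutral_right) auto
    moreover have "(\<Sum>d<?M. ?e d) = fm_scale c x"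
      by (subst sum.delta) auto
    ultimately have "fm_scale c x + y = (\<Sum>d<?M. ?e d + h d)"
      using h(3) by (simp only: sum.distrib)
    moreover have "?e d + h d \<in> homogeneous d" for d
      using h(1) monomial_in_homogeneous[of _ w] unfolding x scale_monomial
      by (auto simp: homogeneous_def intro!: fmpoly.span_add)
    moreover have "\<forall>d\<ge>?M. ?e d + h d = 0" using h(2) by auto
    ultimately show ?case
      unfolding P_def by (intro exI[of _ "\<lambda>d. ?e d + h d"] exI[of _ ?M]) blast
  qed
  then obtain h N where h: "\<forall>d. h d \<in> homogeneous d" "\<forall>d\<ge>N. h d = 0" "p = (\<Sum>d<N. h d)"
    unfolding P_def by blast
  have sub: "{d. h d \<noteq> 0} \<subseteq> {..<N}" using h(2) by (auto simp: not_le[symmetric])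
  then have "(\<Sum>d | h d \<noteq> 0. h d) = (\<Sum>d<N. h d)"
    by (intro sum.mono_neutral_left) auto
  then show "\<exists>h. decomposes p h"
    unfolding decomposes_def using h sub by (metis finite_lessThan finite_subset)
next
  fix h h' :: "nat \<Rightarrow> ('a, 'b) fmpoly"
  assume hh': "decomposes p h" "decomposes p h'"
  obtain g :: "('a, 'b) fmpoly \<Rightarrow> ('a, 'b) fmpoly fps"
    where add: "\<And>p q. g (p + q) = g p + g q"
      and hom: "\<And>d p. p \<in> homogeneous d \<Longrightarrow> g p = fps_const p * fps_X ^ d"
    using grading_hom by blast
  have g0: "g 0 = 0" using add[of 0 0] by simp
  have gsum: "g (sum f S) = (\<Sum>d\<in>S. g (f d))" if "finite S" for f :: "nat \<Rightarrow> _" and S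
    using that by induction (simp_all add: add g0)
  have "h d = fps_nth (g p) d" if "decomposes p h" for h d
  proof -
    have "g p = (\<Sum>e | h e \<noteq> 0. fps_const (h e) * fps_X ^ e)"
    proof -
      have "g p = (\<Sum>e | h e \<noteq> 0. g (h e))"
        using that gsum[of "{e. h e \<noteq> 0}" h] by (simp add: decomposes_def)
      also have "\<dots> = (\<Sum>e | h e \<noteq> 0. fps_const (h e) * fps_X ^ e)"
        using that by (intro sum.cong refl hom) (simp add: decomposes_def)
      finally show ?thesis .
    qed
    then have "fps_nth (g p) d = (\<Sum>e | h e \<noteq> 0. if e = d then h e else 0)"
      by (auto simp: fps_sum_nth fps_X_power_nth intro!: sum.cong)
    also have "\<dots> = h d" using that by (simp add: decomposes_def)
    finally show ?thesis ..
  qed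
  with hh' show "h = h'" by (metis ext)
qed

lemma decomposes_component: "decomposes p (\<lambda>d. component d p)"
  using theI'[OF decomposes_ex1[of p]] unfolding component_def by simp

lemma component_unique: "decomposes p h \<Longrightarrow> component d p = h d"
  using decomposes_ex1[of p] decomposes_component[of p] by metis

lemma leading_form_homogeneous: "leading_form p \<in> homogeneous (fm_degree p)"
  using decomposes_component[of p] by (simp add: leading_form_def decomposes_def)

lemma leading_form_nonzero: "p \<noteq> 0 \<Longrightarrow> leading_form p \<noteq> 0"
proof -
  assume "p \<noteq> 0"
  then have "finite {d. component d p \<noteq> 0}" "{d. component d p \<noteq> 0} \<noteq> {}"
    using decomposes_component[of p] unfolding decomposes_def by force+
  then have "Max {d. component d p \<noteq> 0} \<in> {d. component d p \<noteq> 0}" by (rule Max_in)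
  then show ?thesis by (simp add: leading_form_def fm_degree_def)
qed

lemma adj_homogeneous:
  fixes p :: "('n::finite, 'k) fmpoly"
  assumes "p \<in> homogeneous d" shows "adj p \<in> homogeneous d"
proof -
  have snoc: "p * (var i * coef B) \<in> homogeneous (Suc d)" if "p \<in> homogeneous d"
    for p :: "('n, 'k) fmpoly" and i B d
    using that unfolding homogeneous_def
  proof (induction rule: fmpoly.span_induct_alt)
    case base show ?case by (simp add: fmpoly.span_zero)
  next
    case (step c x y)
    then obtain A w where x: "x = monomial A w" and d: "length w = d" by blast
    have "(fm_scale c x + y) * (var i * coef B) =
        monomial (mat c ** A) (w @ [(i, B)]) + y * (var i * coef B)"
      by (simp add: x scale_monomial distrib_right monomial_snoc mult.assoc)
    moreover have "\<dots> \<in> fmpoly.span {monomial A w | A w. length w = Suc d}"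
      using step by (intro fmpoly.span_add[OF fmpoly.span_base]) (force simp: d)+
    ultimately show ?case by simp
  qed
  have r: "p * coef C \<in> homogeneous d" if "p \<in> homogeneous d"
    for p :: "('n, 'k) fmpoly" and C d
    using that unfolding homogeneous_def
  proof (induction rule: fmpoly.span_induct_alt)
    case base show ?case by (simp add: fmpoly.span_zero)
  next
    case (step c x y)
    then obtain A w where x: "x = monomial A w" and d: "length w = d" by blast
    have "\<exists>A' w'. monomial A w * coef C = monomial A' w' \<and> length w' = length w"
    proof (cases w rule: rev_cases)
      case Nil
      have "monomial A w * coef C = monomial (A ** C) w"
        by (simp add: Nil monomial_def coef_mult)
      then show ?thesis by blast
    next
      case (snoc v b)
      obtain i B where b: "b = (i, B)" by (cases b)
      have "monomial A w * coef C = monomial A (v @ [(i, B ** C)])"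
        by (simp add: snoc b monomial_snoc coef_mult mult.assoc)
      then show ?thesis using snoc by fastforce
    qed
    then obtain A' w' where w': "monomial A w * coef C = monomial A' w'" "length w' = d"
      using d by auto
    have "(fm_scale c x + y) * coef C = fm_scale c (monomial A w * coef C) + y * coef C"
      by (simp add: x fm_scale_def distrib_right mult.assoc)
    moreover have "\<dots> \<in> fmpoly.span {monomial A w | A w. length w = d}"
      unfolding w'(1) scale_monomial using step w'(2)
      by (intro fmpoly.span_add[OF fmpoly.span_base]) blast+
    ultimately show ?case by simp
  qed
  have mono: "adj (monomial A w) \<in> homogeneous (length w)" for A and w :: "('k \<times> (complex^'n^'n)) list"
  proof -
    have "adj (prod_list (map (\<lambda>(i, B). var i * coef B) w)) \<in> homogeneous (length w)"
    proof (induction w)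
      case Nil
      have "adj 1 = (1 :: ('n, 'k) fmpoly)"
        by (metis adj_coef coef_one complex_cnj_one ctranspose_mat)
      moreover have "(1 :: ('n, 'k) fmpoly) = monomial (mat 1) []"
        by (simp add: monomial_def coef_one)
      moreover have "(monomial (mat 1) [] :: ('n, 'k) fmpoly) \<in> homogeneous 0"
        using monomial_in_homogeneous[of "mat 1" "[]"] by simp
      ultimately show ?case by simp
    next
      case (Cons v w)
      obtain i B where v: "v = (i, B)" by (cases v)
      have "q * (coef C * var i) \<in> homogeneous (Suc d)" if "q \<in> homogeneous d"
        for q :: "('n, 'k) fmpoly" and C d
        using snoc[OF r[OF that, of C], of i "mat 1"] by (simp add: coef_one mult.assoc)
      with Cons show ?case by (simp add: v adj_mult adj_var adj_coef)
    qed
    then show ?thesis by (simp add: monomial_def adj_mult adj_coef r)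
  qed
  from assms show ?thesis unfolding homogeneous_def
  proof (induction rule: fmpoly.span_induct_alt)
    case base
    have "adj (0 :: ('n, 'k) fmpoly) = 0"
      using adj_coef[of 0] by (simp add: coef_zero ctranspose_0)
    then show ?case by (simp add: fmpoly.span_zero)
  next
    case (step c x y)
    then obtain A w where x: "x = monomial A w" and d: "length w = d" by blast
    show ?case using step mono[of A w] d
      by (simp add: x adj_add adj_scale homogeneous_def fmpoly.span_add fmpoly.span_scale)
  qed
qed

lemma self_adjoint_leading_form: "self_adjoint p \<Longrightarrow> self_adjoint (leading_form p)"
proof -
  assume p: "self_adjoint p"
  have adj0: "adj q = 0 \<longleftrightarrow> q = 0" for q :: "('a, 'b) fmpoly"
    by (metis adj_adj adj_sum sum.empty)
  have "decomposes (adj p) (\<lambda>d. adj (component d p))"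
    using decomposes_component[of p] unfolding decomposes_def adj0
    by (auto intro: adj_homogeneous simp: adj_sum[symmetric])
  then have "adj (component d p) = component d p" for d
    using p component_unique by (metis self_adjoint_def)
  then show ?thesis by (simp add: leading_form_def self_adjoint_def)
qed


section \<open>Non-degenerate tuples\<close>

text \<open>A predicate for tuples of homogeneous self-adjoint elements; the leading forms of self-adjoint
  elements are such by \<open>leading_form_homogeneous\<close> and \<open>self_adjoint_leading_form\<close>.\<close>

definition nondegenerate :: "('k \<Rightarrow> ('n::finite, 'k) fmpoly) \<Rightarrow> bool"
  where "nondegenerate q \<longleftrightarrow>
    (\<forall>X :: 'k \<Rightarrow> complex^'n^'n. (\<forall>i. hermitian (X i)) \<longrightarrow> (\<forall>i. eval X (q i) = 0) \<longrightarrow> (\<forall>i. X i = 0))"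

end

theory Submission
  imports "HOL-Homology.Homology" Defs
begin

text \<open>A continuous family of maps joins the leading forms to the polynomials: for \<open>t > 0\<close> multiply
  the degree \<open>d\<close> component of the \<open>i\<close>-th polynomial, of degree \<open>d\<^sub>i\<close>, by \<open>t\<close> to the power
  \<open>d\<^sub>i - d\<close>, which amounts to evaluating at \<open>X / t\<close> and rescaling. If the polynomials had no common
  Hermitian zero, no member of the family would vanish on the unit sphere (non-degeneracy covers
  \<open>t = 0\<close>), and the polynomials themselves extend without zeros over the ball. Hence the leading forms
  would give an odd map of the sphere that is null-homotopic, contradicting Borsuk's theorem that
  odd maps have odd degree. For differentiable maps the latter follows by induction on the dimension:
  the image of a hyperplane misses a direction, projecting along which deforms the map into one that
  preserves the equator.\<close>

section \<open>Odd maps of spheres have odd degree\<close>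

lemma differentiable_on_punctured_iff:
  fixes f :: "'a::euclidean_space \<Rightarrow> 'b::real_normed_vector"
  shows "f differentiable_on -{0} \<longleftrightarrow> (\<forall>v. v \<noteq> 0 \<longrightarrow> f differentiable (at v))"
  by (auto simp: differentiable_on_eq_differentiable_at open_Compl)

section \<open>Coordinate subspaces and their unit spheres\<close>

locale enumerated_basis =
  fixes b :: "nat \<Rightarrow> 'a::euclidean_space"
  assumes bij_b: "bij_betw b {..<DIM('a)} Basis"
begin

text \<open>The span of \<open>b 0\<close>, ..., \<open>b n\<close>, of dimension
  \<open>n + 1\<close> when \<open>n < DIM('a)\<close>; its unit sphere is the model of
  \<open>nsphere n\<close>.\<close>

definition flag :: "nat \<Rightarrow> 'a set"
  where "flag n = {v. \<forall>i. n < i \<and> i < DIM('a) \<longrightarrow> v \<bullet> b i = 0}"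

definition vec_of :: "(nat \<Rightarrow> real) \<Rightarrow> 'a"
  where "vec_of x = (\<Sum>i<DIM('a). x i *\<^sub>R b i)"

definition coords :: "'a \<Rightarrow> nat \<Rightarrow> real"
  where "coords v = (\<lambda>i. if i < DIM('a) then v \<bullet> b i else 0)"

text \<open>\<open>Brouwer_degree2\<close> concerns self-maps of \<open>nsphere n\<close>, whose
  points are real sequences. The formula does not mention \<open>n\<close>, so one function serves
  on a sphere and on its equator.\<close>

definition sphere_map :: "('a \<Rightarrow> 'a) \<Rightarrow> (nat \<Rightarrow> real) \<Rightarrow> nat \<Rightarrow> real"
  where "sphere_map F = (\<lambda>x. coords (sgn (F (vec_of x))))"

lemma inner_b: "i < DIM('a) \<Longrightarrow> j < DIM('a) \<Longrightarrow> b i \<bullet> b j = (if i = j then 1 else 0)"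
  using bij_betwE[OF bij_b] inj_onD[OF bij_betw_imp_inj_on[OF bij_b], of i j]
  by (auto simp: inner_Basis)

lemma b_nonzero: "i < DIM('a) \<Longrightarrow> b i \<noteq> 0"
  using inner_b[of i i] by force

lemma sum_coords: "(\<Sum>i<DIM('a). (v \<bullet> b i) *\<^sub>R b i) = v"
  using euclidean_representation[of v] sum.reindex_bij_betw[OF bij_b, of "\<lambda>u. (v \<bullet> u) *\<^sub>R u"] by simp

lemma inner_vec_of: "i < DIM('a) \<Longrightarrow> vec_of x \<bullet> b i = x i"
  by (simp add: vec_of_def inner_sum_left inner_b if_distrib[of "\<lambda>c. _ * c"] cong: if_cong)

lemma norm_flag:
  assumes "n < DIM('a)" "v \<in> flag n"
  shows "(norm v)\<^sup>2 = (\<Sum>i\<le>n. (v \<bullet> b i)\<^sup>2)"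
proof -
  have "(norm v)\<^sup>2 = v \<bullet> (\<Sum>i<DIM('a). (v \<bullet> b i) *\<^sub>R b i)"
    by (simp only: sum_coords power2_norm_eq_inner)
  also have "\<dots> = (\<Sum>i<DIM('a). (v \<bullet> b i)\<^sup>2)"
    by (simp add: inner_sum_right power2_eq_square)
  also have "\<dots> = (\<Sum>i\<le>n. (v \<bullet> b i)\<^sup>2)"
    using assms by (intro sum.mono_neutral_right) (auto simp: flag_def)
  finally show ?thesis .
qed

lemma nsphere_top_of_set: "nsphere n = top_of_set {x. (\<Sum>i\<le>n. x i ^ 2) = 1 \<and> (\<forall>i>n. x i = 0)}"
  by (simp add: nsphere euclidean_product_topology)

lemma topspace_nsphere: "topspace (nsphere n) = {x. (\<Sum>i\<le>n. x i ^ 2) = 1 \<and> (\<forall>i>n. x i = 0)}"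
  by (simp add: nsphere_top_of_set)

lemma vec_of_in_flag:
  assumes "n < DIM('a)" "x \<in> topspace (nsphere n)"
  shows "vec_of x \<in> flag n \<inter> sphere 0 1"
proof -
  have fl: "vec_of x \<in> flag n"
    using assms by (auto simp: flag_def topspace_nsphere inner_vec_of)
  then have "(norm (vec_of x))\<^sup>2 = (\<Sum>i\<le>n. (x i)\<^sup>2)"
    using assms(1) by (subst norm_flag[of n]) (auto simp: inner_vec_of intro!: sum.cong)
  then have "norm (vec_of x) = 1"
    using assms(2) by (simp add: topspace_nsphere power2_eq_iff_nonneg[of _ 1, simplified])
  with fl show ?thesis by simp
qed

lemma coords_in_nsphere:
  assumes "n < DIM('a)" "v \<in> flag n" "norm v = 1"
  shows "coords v \<in> topspace (nsphere n)"
proof -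
  have "(\<Sum>i\<le>n. (coords v i)\<^sup>2) = (\<Sum>i\<le>n. (v \<bullet> b i)\<^sup>2)"
    using assms(1) by (intro sum.cong) (auto simp: coords_def)
  also have "\<dots> = 1"
    using norm_flag[OF assms(1,2)] assms(3) by simp
  finally show ?thesis
    using assms(2) by (simp add: topspace_nsphere coords_def flag_def)
qed

lemma coords_vec_of:
  assumes "n < DIM('a)" "x \<in> topspace (nsphere n)"
  shows "coords (vec_of x) = x"
  using assms by (auto simp: coords_def inner_vec_of topspace_nsphere)

lemma coords_scaleR: "coords (c *\<^sub>R v) = (\<lambda>i. c * coords v i)"
  by (auto simp: coords_def)

lemma scaleR_flag: "v \<in> flag n \<Longrightarrow> c *\<^sub>R v \<in> flag n"
  by (simp add: flag_def)

lemma sgn_flag: "v \<in> flag n - {0} \<Longrightarrow> sgn v \<in> flag n \<and> norm (sgn v) = 1"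
  by (simp add: sgn_div_norm scaleR_flag)

lemma continuous_map_vec_of:
  assumes "n < DIM('a)"
  shows "continuous_map (nsphere n) (top_of_set (flag n \<inter> sphere 0 1)) vec_of"
proof -
  have "continuous_on T vec_of" for T
    unfolding vec_of_def by (intro continuous_intros continuous_on_subset[OF continuous_on_product_coordinates]) simp
  then show ?thesis
    using vec_of_in_flag[OF assms] unfolding nsphere_top_of_set topspace_nsphere by auto
qed

lemma continuous_map_coords_sgn:
  assumes "n < DIM('a)"
  shows "continuous_map (top_of_set (flag n - {0})) (nsphere n) (\<lambda>v. coords (sgn v))"
proof -
  have "continuous_on (flag n - {0}) (\<lambda>v. coords (sgn v))"
    unfolding coords_def
  proof (rule continuous_on_coordinatewise_then_product)
    show "continuous_on (flag n - {0}) (\<lambda>v. if i < DIM('a) then sgn v \<bullet> b i else 0)" for i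
      unfolding sgn_div_norm by (cases "i < DIM('a)") (auto intro!: continuous_intros)
  qed
  then show ?thesis
    using coords_in_nsphere[OF assms] sgn_flag unfolding nsphere_top_of_set topspace_nsphere by auto
qed

text \<open>Normalising by \<open>sgn\<close> turns a homotopy through nonvanishing maps into one of
  self-maps of the sphere.\<close>

lemma homotopic_sphere_map:
  assumes n: "n < DIM('a)"
    and h: "homotopic_with_canon (\<lambda>_. True) (flag n \<inter> sphere 0 1) (flag n - {0}) F G"
  shows "homotopic_with (\<lambda>_. True) (nsphere n) (nsphere n) (sphere_map F) (sphere_map G)"
proof -
  have "homotopic_with (\<lambda>_. True) (nsphere n) (top_of_set (flag n - {0})) (F \<circ> vec_of) (G \<circ> vec_of)"
    by (rule homotopic_with_compose_continuous_map_right[OF h continuous_map_vec_of[OF n]]) simp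
  from homotopic_with_compose_continuous_map_left[OF this continuous_map_coords_sgn[OF n]]
  show ?thesis by (simp add: sphere_map_def o_def)
qed

section \<open>The degree of an odd map, by induction on the dimension\<close>

text \<open>A differentiable image of \<open>flag m\<close> is too thin to fill
  \<open>flag (Suc m)\<close>. The point \<open>p\<close> will give the direction of a projection
  onto \<open>flag m\<close>, to which it is transversal by
  \<open>p \<bullet> b (Suc m) \<noteq> 0\<close>.\<close>

lemma avoid_image:
  assumes m: "Suc m < DIM('a)" and F0: "F 0 = (0::'a)" and F: "F differentiable_on -{0}"
  obtains p where "p \<in> flag (Suc m)" "p \<bullet> b (Suc m) \<noteq> 0" "p \<notin> F ` flag m"
proof -
  \<comment> \<open>Extending \<open>F\<close> by the identity on the complement of the subspace turns the claim into one about
    the null image of a hyperplane of the whole space.\<close>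
  define pr where "pr x = (\<Sum>i\<le>m. (x \<bullet> b i) *\<^sub>R b i)" for x
  define H where "H x = F (pr x) + (x - pr x)" for x
  \<comment> \<open>Points with \<open>pr x = 0\<close> are left out because \<open>F\<close> need
    not be differentiable at \<open>0\<close>.\<close>
  define D where "D = {x. b (Suc m) \<bullet> x = 0 \<and> pr x \<noteq> 0}"
  have pr_diff: "pr differentiable (at x within T)" for x T
    unfolding pr_def by (intro derivative_intros) auto
  have "H differentiable (at x)" if "x \<in> D" for x
  proof -
    have "F differentiable (at (pr x))"
      using F that by (simp add: D_def differentiable_on_punctured_iff)
    then have "(F \<circ> pr) differentiable (at x)"
      by (rule differentiable_chain_at[OF pr_diff])
    then show ?thesis
      unfolding H_def o_def by (intro derivative_intros pr_diff) 
  qed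
  then have "H differentiable_on D"
    by (auto simp: differentiable_on_def intro: differentiable_at_withinI)
  moreover have "negligible D"
    by (rule negligible_subset[OF negligible_hyperplane[of "b (Suc m)" 0]])
      (use m in \<open>auto simp: D_def b_nonzero\<close>)
  ultimately have "negligible (H ` D)"
    by (intro negligible_differentiable_image_negligible) auto
  \<comment> \<open>Avoiding the hyperplane as well gives \<open>v\<close>, and hence its projection
    \<open>p\<close> to \<open>flag (Suc m)\<close>, a nonzero coordinate along
    \<open>b (Suc m)\<close>.\<close>
  then have "negligible (H ` D \<union> {x. b (Suc m) \<bullet> x = 0})"
    using m by (intro negligible_Un negligible_hyperplane) (auto simp: b_nonzero)
  then obtain v where v: "v \<notin> H ` D" "b (Suc m) \<bullet> v \<noteq> 0"
    using non_negligible_UNIV by (metis (mono_tags, lifting) UNIV_eq_I UnI1 UnI2 mem_Collect_eq)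
  define p where "p = (\<Sum>i\<le>Suc m. (v \<bullet> b i) *\<^sub>R b i)"
  have p_inner: "p \<bullet> b i = (if i \<le> Suc m then v \<bullet> b i else 0)" if "i < DIM('a)" for i
  proof -
    have "p \<bullet> b i = (\<Sum>j\<le>Suc m. if j = i then v \<bullet> b j else 0)"
      unfolding p_def inner_sum_left using that m by (intro sum.cong) (auto simp: inner_b)
    then show ?thesis by (simp add: sum.delta del: sum.atMost_Suc)
  qed
  have pr_flag: "pr y = y" if "y \<in> flag m" for y
    unfolding pr_def by (rule trans[OF _ sum_coords], rule sum.mono_neutral_left)
      (use m that in \<open>auto simp: flag_def\<close>)
  have pr_diff0: "pr (v - p) = 0"
    unfolding pr_def using m by (intro sum.neutral) (auto simp: inner_diff_left p_inner)
  have pr_add: "pr (x + y) = pr x + pr y" for x y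
    by (simp add: pr_def inner_add_left scaleR_add_left sum.distrib)
  \<comment> \<open>If \<open>p = F y\<close>, then \<open>y + (v - p)\<close> lies in
    \<open>D\<close> and \<open>H\<close> sends it to \<open>v\<close>: the summand
    \<open>v - p\<close> has coordinates only beyond \<open>Suc m\<close>, and \<open>H\<close>
    leaves these unchanged.\<close>
  have "p \<notin> F ` flag m"
  proof
    assume "p \<in> F ` flag m"
    then obtain y where y: "y \<in> flag m" "p = F y" by blast
    have "y \<noteq> 0" using y v p_inner[of "Suc m"] m F0 by (auto simp: inner_commute)
    moreover have "b (Suc m) \<bullet> (y + (v - p)) = 0"
      using y(1) p_inner[of "Suc m"] m by (simp add: flag_def inner_add_left inner_diff_left inner_commute[of "b (Suc m)"])
    moreover have "pr (y + (v - p)) = y"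
      using y(1) by (simp add: pr_add pr_flag pr_diff0)
    ultimately have "y + (v - p) \<in> D" "H (y + (v - p)) = v"
      by (simp_all add: D_def H_def flip: y(2))
    with v(1) show False by (metis imageI)
  qed
  with p_inner v m show ?thesis
    by (intro that[of p]) (auto simp: flag_def inner_commute)
qed

text \<open>Homogeneity under all real factors combines oddness with radial extension from the
  sphere, and composition with a linear projection keeps it. The ambient space stays fixed in the
  induction; only \<open>flag n\<close> changes.\<close>

theorem odd_degree_sphere_map:
  assumes "n < DIM('a)"
    and "\<And>t x. F (t *\<^sub>R x) = t *\<^sub>R F x"
    and "F differentiable_on -{0}"
    and "F \<in> flag n - {0} \<rightarrow> flag n - {0}"
  shows "odd (Brouwer_degree2 n (sphere_map F))"
  using assms
proof (induction n arbitrary: F)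
  case 0
  have b0: "b 0 \<in> flag 0 - {0}"
    by (auto simp: flag_def inner_b b_nonzero)
  have expand: "v = (v \<bullet> b 0) *\<^sub>R b 0" if "v \<in> flag 0" for v
  proof -
    have "v = (\<Sum>i<DIM('a). (v \<bullet> b i) *\<^sub>R b i)" by (simp add: sum_coords)
    also have "\<dots> = (\<Sum>i\<in>{0}. (v \<bullet> b i) *\<^sub>R b i)"
      by (rule sum.mono_neutral_right) (use that in \<open>auto simp: flag_def\<close>)
    finally show ?thesis by simp
  qed
  \<comment> \<open>On the line \<open>flag 0\<close> the map is multiplication by \<open>c\<close>,
    so on the two-point sphere it is the identity or the reflection, of degree \<open>1\<close> or
    \<open>-1\<close>.\<close>
  define c where "c = F (b 0) \<bullet> b 0"
  have Fb0: "F (b 0) \<in> flag 0 - {0}" using "0.prems"(4) b0 by blast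
  then have Fb: "F (b 0) = c *\<^sub>R b 0" using expand[of "F (b 0)"] unfolding c_def by blast
  with Fb0 have c: "c \<noteq> 0" by auto
  have Fv: "F v = c *\<^sub>R v" if "v \<in> flag 0" for v
    by (metis "0.prems"(2) Fb expand scaleR_left_commute that)
  have s: "sphere_map F x = (\<lambda>i. sgn c * x i)" if x: "x \<in> topspace (nsphere 0)" for x
  proof -
    have v: "vec_of x \<in> flag 0" "norm (vec_of x) = 1" using vec_of_in_flag[OF _ x] by auto
    then have "sgn (F (vec_of x)) = sgn c *\<^sub>R vec_of x"
      by (simp add: Fv sgn_scaleR sgn_div_norm)
    then show ?thesis
      using coords_vec_of[OF _ x] by (simp add: sphere_map_def coords_scaleR)
  qed
  show ?case
  proof (cases "c > 0")
    case True
    then have "Brouwer_degree2 0 (sphere_map F) = Brouwer_degree2 0 id"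
      by (intro Brouwer_degree2_eq) (simp add: s)
    then show ?thesis by simp
  next
    case False
    then have "Brouwer_degree2 0 (sphere_map F) = Brouwer_degree2 0 (\<lambda>x i. if i = 0 then - x i else x i)"
      using c by (intro Brouwer_degree2_eq) (auto simp: s topspace_nsphere)
    then show ?thesis by (simp add: Brouwer_degree2_reflection)
  qed
next
  case (Suc m)
  note hom = Suc.prems(2) and diff = Suc.prems(3) and into = Suc.prems(4)
  have F0: "F 0 = 0" using hom[of 0 0] by simp
  obtain p where p: "p \<in> flag (Suc m)" "p \<bullet> b (Suc m) \<noteq> 0" "p \<notin> F ` flag m"
    using avoid_image[OF Suc.prems(1) F0 diff] by blast
  \<comment> \<open>The linear projection along \<open>p\<close> onto the hyperplane orthogonal to
    \<open>b (Suc m)\<close>; it carries \<open>flag (Suc m)\<close> to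
    \<open>flag m\<close>.\<close>
  define \<pi> where "\<pi> v = v - (v \<bullet> b (Suc m) / (p \<bullet> b (Suc m))) *\<^sub>R p" for v
  have \<pi>_scale: "\<pi> (t *\<^sub>R v) = t *\<^sub>R \<pi> v" for t v
    by (simp add: \<pi>_def scaleR_diff_right)
  have \<pi>_add: "\<pi> (v + w) = \<pi> v + \<pi> w" for v w
    by (simp add: \<pi>_def inner_add_left add_divide_distrib scaleR_add_left)
  have \<pi>_idem: "\<pi> (\<pi> v) = \<pi> v" for v
    using p(2) by (simp add: \<pi>_def inner_diff_left)
  have \<pi>_inner: "\<pi> v \<bullet> b (Suc m) = 0" for v
    using p(2) by (simp add: \<pi>_def inner_diff_left)
  have flag_mono: "flag m \<subseteq> flag (Suc m)" by (auto simp: flag_def)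
  have \<pi>_flag_Suc: "\<pi> v \<in> flag (Suc m)" if "v \<in> flag (Suc m)" for v
    using p(1) that by (simp add: \<pi>_def flag_def inner_diff_left)
  have flagI: "v \<in> flag m" if "v \<in> flag (Suc m)" "v \<bullet> b (Suc m) = 0" for v
    using that by (auto simp: flag_def) (metis Suc_lessI)
  have \<pi>_flag: "\<pi> v \<in> flag m" if "v \<in> flag (Suc m)" for v
    using that \<pi>_flag_Suc \<pi>_inner flagI by blast
  \<comment> \<open>The kernel of \<open>\<pi>\<close> consists of multiples of \<open>p\<close>, so
    a zero would give \<open>F v = c *\<^sub>R p\<close> with \<open>c \<noteq> 0\<close>, and
    homogeneity would put \<open>p\<close> into the image of \<open>flag m\<close>.\<close>
  have \<pi>F_nz: "\<pi> (F v) \<noteq> 0" if "v \<in> flag m - {0}" for v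
  proof
    assume "\<pi> (F v) = 0"
    then obtain c where c: "F v = c *\<^sub>R p" by (auto simp: \<pi>_def)
    have "F v \<noteq> 0" using into that flag_mono by blast
    with c have "p = F ((1 / c) *\<^sub>R v)" by (auto simp: hom)
    with p(3) that show False by (auto intro: scaleR_flag)
  qed
  have \<pi>F_into: "\<pi> (F v) \<in> flag m - {0}" if "v \<in> flag m - {0}" for v
    using that into flag_mono \<pi>_flag[of "F v"] \<pi>F_nz[of v] by blast
  have IH: "odd (Brouwer_degree2 m (sphere_map (\<pi> \<circ> F)))"
  proof (rule Suc.IH)
    have "F differentiable (at v)" if "v \<noteq> 0" for v
      using diff that by (simp add: differentiable_on_punctured_iff)
    then show "(\<pi> \<circ> F) differentiable_on -{0}"
      unfolding \<pi>_def o_def divide_inverse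
      by (auto intro!: derivative_intros simp: differentiable_on_punctured_iff)
    show "\<pi> \<circ> F \<in> flag m - {0} \<rightarrow> flag m - {0}"
      using \<pi>F_into by auto
  qed (use Suc.prems in \<open>auto simp: \<pi>_scale\<close>)
  \<comment> \<open>The segment from \<open>F\<close> to \<open>F1\<close> avoids \<open>0\<close>, since applying \<open>\<pi>\<close> to a zero of a positive
    combination of \<open>F x\<close> and \<open>\<pi> (F x)\<close> gives \<open>\<pi> (F x) = 0\<close>.\<close>
  define F1 where "F1 x = \<bar>x \<bullet> b (Suc m)\<bar> *\<^sub>R F x + \<pi> (F x)" for x
  have F_cont: "continuous_on (flag (Suc m) \<inter> sphere 0 1) F"
    using differentiable_imp_continuous_on[OF diff] by (rule continuous_on_subset) auto
  have F1_cont: "continuous_on (flag (Suc m) \<inter> sphere 0 1) F1"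
    unfolding F1_def \<pi>_def by (intro continuous_intros F_cont) (use p in auto)
  have homot: "homotopic_with_canon (\<lambda>_. True) (flag (Suc m) \<inter> sphere 0 1) (flag (Suc m) - {0}) F F1"
  proof (rule homotopic_with_linear[OF F_cont F1_cont])
    fix x assume x: "x \<in> flag (Suc m) \<inter> sphere 0 1"
    then have x0: "x \<in> flag (Suc m) - {0}" by auto
    have Fx: "F x \<in> flag (Suc m) - {0}" using into x0 by blast
    show "closed_segment (F x) (F1 x) \<subseteq> flag (Suc m) - {0}"
    proof
      fix v assume "v \<in> closed_segment (F x) (F1 x)"
      then obtain t where t: "0 \<le> t" "t \<le> 1" "v = (1 - t) *\<^sub>R F x + t *\<^sub>R F1 x"
        by (auto simp: closed_segment_def)
      define a where "a = (1 - t) + t * \<bar>x \<bullet> b (Suc m)\<bar>"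
      have ta: "t * \<bar>x \<bullet> b (Suc m)\<bar> \<ge> 0" using t by simp
      have v: "v = a *\<^sub>R F x + t *\<^sub>R \<pi> (F x)"
        by (simp add: t F1_def a_def algebra_simps)
      have "v \<noteq> 0"
      proof
        assume v0: "v = 0"
        have "\<pi> v = (a + t) *\<^sub>R \<pi> (F x)"
          by (simp add: v \<pi>_add \<pi>_scale \<pi>_idem scaleR_add_left)
        moreover have "\<pi> v = 0" using v0 by (simp add: \<pi>_def)
        moreover have "a + t > 0" using ta by (simp add: a_def)
        ultimately have \<pi>0: "\<pi> (F x) = 0" by simp
        \<comment> \<open>What remains is \<open>v = a *\<^sub>R F x\<close> with
          \<open>F x \<noteq> 0\<close>. Both summands of \<open>a\<close> are nonnegative, so
          \<open>t = 1\<close> and \<open>x\<close> is on the equator, where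
          \<open>\<pi> (F x)\<close> does not vanish.\<close>
        with v0 v Fx have "a = 0" by auto
        moreover from this have "t = 1" using t ta unfolding a_def by linarith
        ultimately have "x \<bullet> b (Suc m) = 0" by (simp add: a_def)
        then show False using \<pi>F_nz[of x] x0 flagI \<pi>0 by blast
      qed
      moreover have "v \<in> flag (Suc m)"
        using Fx \<pi>_flag_Suc[of "F x"] by (simp add: v flag_def inner_add_left)
      ultimately show "v \<in> flag (Suc m) - {0}" by simp
    qed
  qed
  have deg: "Brouwer_degree2 (Suc m) (sphere_map F) = Brouwer_degree2 (Suc m) (sphere_map F1)"
    by (rule Brouwer_degree2_homotopic[OF homotopic_sphere_map[OF Suc.prems(1) homot]])
  \<comment> \<open>The coefficient of \<open>F x\<close> in \<open>F1 x\<close> vanishes on the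
    equator.\<close>
  have eq_m: "sphere_map F1 x = sphere_map (\<pi> \<circ> F) x" if "x \<in> topspace (nsphere m)" for x
  proof -
    have "x (Suc m) = 0" using that by (simp add: topspace_nsphere)
    then have "vec_of x \<bullet> b (Suc m) = 0" using Suc.prems(1) by (simp add: inner_vec_of)
    then show ?thesis by (simp add: sphere_map_def F1_def)
  qed
  \<comment> \<open>An odd self-map preserving the equator has degrees of equal parity on the sphere
    and on the equator. The absolute value in \<open>F1\<close> is what keeps it odd.\<close>
  have "even (Brouwer_degree2 (Suc m) (sphere_map F1) - Brouwer_degree2 (Suc m - Suc 0) (sphere_map F1))"
  proof (rule Borsuk_odd_mapping_degree_step)
    show "continuous_map (nsphere (Suc m)) (nsphere (Suc m)) (sphere_map F1)"
      using homotopic_with_imp_continuous_maps[OF homotopic_sphere_map[OF Suc.prems(1) homot]] by simp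
    have "vec_of (\<lambda>i. - x i) = - vec_of x" for x by (simp add: vec_of_def sum_negf)
    moreover have "F1 (- v) = - F1 v" for v
      using hom[of "-1" v] \<pi>_scale[of "-1" "F v"] by (simp add: F1_def)
    moreover have "coords (- v) = (\<lambda>i. - coords v i)" for v
      using coords_scaleR[of "-1" v] by simp
    ultimately show "(sphere_map F1 \<circ> (\<lambda>x i. - x i)) u = ((\<lambda>x i. - x i) \<circ> sphere_map F1) u" for u
      by (simp add: sphere_map_def sgn_minus)
    show "sphere_map F1 \<in> topspace (nsphere (Suc m - Suc 0)) \<rightarrow> topspace (nsphere (Suc m - Suc 0))"
    proof
      fix x assume x: "x \<in> topspace (nsphere (Suc m - Suc 0))"
      have m: "m < DIM('a)" using Suc.prems(1) by simp
      have "vec_of x \<in> flag m \<inter> sphere 0 1" using vec_of_in_flag[OF m] x by simp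
      then have "vec_of x \<in> flag m - {0}" by auto
      then have "(\<pi> \<circ> F) (vec_of x) \<in> flag m - {0}"
        using \<pi>F_into by simp
      then have "sphere_map (\<pi> \<circ> F) x \<in> topspace (nsphere m)"
        unfolding sphere_map_def using coords_in_nsphere[OF m] sgn_flag by blast
      then show "sphere_map F1 x \<in> topspace (nsphere (Suc m - Suc 0))" using eq_m x by simp
    qed
  qed
  moreover have "Brouwer_degree2 m (sphere_map F1) = Brouwer_degree2 m (sphere_map (\<pi> \<circ> F))"
    by (rule Brouwer_degree2_eq) (rule eq_m)
  ultimately show ?case using IH deg by simp
qed

end

section \<open>Null-homotopies of odd maps\<close>

text \<open>A null-homotopic map would have degree \<open>0\<close>, which is even. The parity
  theorem asks for homogeneity, so \<open>F\<close> is replaced by the radial extension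
  \<open>G\<close> of its restriction to the unit sphere; oddness of \<open>F\<close> covers
  negative factors.\<close>

theorem odd_map_not_nullhomotopic:
  fixes F :: "'a::euclidean_space \<Rightarrow> 'a"
  assumes odd: "\<And>x. F (- x) = - F x" and diff: "F differentiable_on -{0}"
    and nz: "\<And>x. x \<noteq> 0 \<Longrightarrow> F x \<noteq> 0"
  shows "\<not> homotopic_with_canon (\<lambda>_. True) (sphere 0 1) (- {0}) F (\<lambda>_. a)"
proof
  assume h: "homotopic_with_canon (\<lambda>_. True) (sphere 0 1) (- {0}) F (\<lambda>_. a)"
  obtain b :: "nat \<Rightarrow> 'a" where "bij_betw b {..<DIM('a)} Basis"
    using ex_bij_betw_nat_finite[of "Basis :: 'a set"] by (auto simp: atLeast0LessThan)
  then interpret enumerated_basis b by unfold_locales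
  \<comment> \<open>The unit sphere of a space of dimension \<open>n + 1\<close> is
    \<open>nsphere n\<close>.\<close>
  define n where "n = DIM('a) - 1"
  have n: "n < DIM('a)" by (simp add: n_def)
  have flag: "flag n = UNIV" by (auto simp: flag_def n_def)
  define G where "G x = norm x *\<^sub>R F (sgn x)" for x
  have "odd (Brouwer_degree2 n (sphere_map G))"
  proof (rule odd_degree_sphere_map[OF n])
    show "G (t *\<^sub>R x) = t *\<^sub>R G x" for t x
      by (cases t "0::real" rule: linorder_cases) (simp_all add: G_def sgn_scaleR odd)
    have "G differentiable (at x)" if "x \<noteq> 0" for x
    proof -
      have "F differentiable (at (sgn x))"
        using diff that by (simp add: differentiable_on_punctured_iff sgn_zero_iff)
      moreover have "sgn differentiable (at x)"
        unfolding sgn_div_norm by (intro derivative_intros differentiable_norm_at) (use that in auto)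
      ultimately have "(F \<circ> sgn) differentiable (at x)"
        by (intro differentiable_chain_at)
      then show ?thesis unfolding G_def o_def
        by (intro derivative_intros differentiable_norm_at that)
    qed
    then show "G differentiable_on -{0}"
      by (simp add: differentiable_on_punctured_iff)
    show "G \<in> flag n - {0} \<rightarrow> flag n - {0}"
      using nz by (auto simp: G_def flag sgn_zero_iff)
  qed
  moreover have "homotopic_with_canon (\<lambda>_. True) (flag n \<inter> sphere 0 1) (flag n - {0}) G (\<lambda>_. a)"
  proof -
    have "homotopic_with_canon (\<lambda>_. True) (sphere 0 1) (- {0}) G (\<lambda>_. a)"
      by (rule homotopic_with_eq[OF h]) (auto simp: G_def sgn_div_norm)
    then show ?thesis by (simp add: flag Compl_eq_Diff_UNIV)
  qed
  then have "Brouwer_degree2 n (sphere_map G) = Brouwer_degree2 n (sphere_map (\<lambda>_. a))"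
    by (rule Brouwer_degree2_homotopic[OF homotopic_sphere_map[OF n]])
  ultimately show False by (simp add: sphere_map_def Brouwer_degree2_const)
qed


section \<open>Evaluation of free matrix polynomials\<close>

lemma bounded_bilinear_matrix_mult: "bounded_bilinear ((**) :: complex^'n^'n \<Rightarrow> complex^'n^'n \<Rightarrow> _)"
  unfolding bilinear_conv_bounded_bilinear[symmetric] bilinear_def linear_iff
  by (simp add: vec_eq_iff matrix_matrix_mult_def distrib_left distrib_right sum.distrib scaleR_sum_right)

lemma eval_0: "eval X 0 = 0"
  using eval_coef[of X 0] by (simp add: coef_zero)

lemma eval_sum: "eval X (sum f S) = (\<Sum>s\<in>S. eval X (f s))"
  by (induction S rule: infinite_finite_induct) (simp_all add: eval_0 eval_add)

text \<open>With \<open>c = 1 / t\<close> this relates the deformed polynomials to the original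
  ones; with \<open>c = -1\<close> it makes leading forms of odd degree odd maps.\<close>

lemma eval_scaleR_homogeneous:
  assumes "q \<in> homogeneous d"
  shows "eval (\<lambda>i. c *\<^sub>R X i) q = c ^ d *\<^sub>R eval X q"
  using assms unfolding homogeneous_def
proof (induction rule: fmpoly.span_induct_alt)
  case base
  show ?case by (simp add: eval_0)
next
  case (step a x y)
  interpret bounded_bilinear "(**) :: complex^'a^'a \<Rightarrow> complex^'a^'a \<Rightarrow> _"
    by (rule bounded_bilinear_matrix_mult)
  obtain A w where x: "x = monomial A w" and d: "length w = d" using step by blast
  have one: "eval Y 1 = mat 1" for Y :: "'b \<Rightarrow> complex^'a^'a"
    by (metis coef_one eval_coef)
  have "eval (\<lambda>i. c *\<^sub>R X i) (prod_list (map (\<lambda>(i, B). var i * coef B) w)) =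
      c ^ length w *\<^sub>R eval X (prod_list (map (\<lambda>(i, B). var i * coef B) w))"
    by (induction w) (auto simp: one eval_mult eval_var eval_coef scaleR_left scaleR_right mult.commute)
  then show ?case using step
    by (simp add: x d monomial_def fm_scale_def eval_add eval_mult eval_coef scaleR_right scaleR_add_right)
qed

text \<open>Since \<open>adj\<close> fixes the variables, \<open>ctranspose\<close> must fix their
  values.\<close>

lemma eval_adj:
  assumes "\<And>i. hermitian (X i)"
  shows "eval X (adj p) = ctranspose (eval X p)"
  by (induction p rule: fmpoly_induct)
    (use assms in \<open>simp_all add: adj_coef adj_var adj_add adj_mult eval_coef eval_var eval_add eval_mult
      ctranspose_add ctranspose_mult hermitian_def\<close>)

lemma hermitian_eval: "(\<And>i. hermitian (X i)) \<Longrightarrow> self_adjoint p \<Longrightarrow> hermitian (eval X p)"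
  using eval_adj[of X p] by (simp add: hermitian_def self_adjoint_def)

lemma continuous_on_eval:
  assumes "\<And>i. continuous_on S (\<lambda>v. X v i)"
  shows "continuous_on S (\<lambda>v. eval (X v) p)"
  by (induction p rule: fmpoly_induct)
    (simp_all add: assms eval_coef eval_var eval_add eval_mult continuous_on_add
      bounded_bilinear.continuous_on[OF bounded_bilinear_matrix_mult])

lemma differentiable_eval:
  assumes "\<And>i. (\<lambda>v. X v i) differentiable (at v)"
  shows "(\<lambda>v. eval (X v) p) differentiable (at v)"
proof (induction p rule: fmpoly_induct)
  case (mult a b)
  then obtain A B where "((\<lambda>v. eval (X v) a) has_derivative A) (at v)"
    and "((\<lambda>v. eval (X v) b) has_derivative B) (at v)"
    unfolding differentiable_def by blast
  from bounded_bilinear.FDERIV[OF bounded_bilinear_matrix_mult this]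
  show ?case by (auto simp: eval_mult differentiable_def)
qed (simp_all add: assms eval_coef eval_var eval_add)

lemma differentiable_linear_compose:
  fixes f :: "'a::real_normed_vector \<Rightarrow> 'b::euclidean_space" and g :: "'b \<Rightarrow> 'c::real_normed_vector"
  assumes "f differentiable (at x)" "linear g"
  shows "(\<lambda>x. g (f x)) differentiable (at x)"
  using differentiable_chain_at[OF assms(1) linear_imp_differentiable[OF assms(2)]] by (simp add: o_def)

lemma differentiable_vec_lambda:
  fixes f :: "'a::real_normed_vector \<Rightarrow> 'i::finite \<Rightarrow> 'b::euclidean_space"
  assumes "\<And>i. (\<lambda>x. f x i) differentiable (at x)"
  shows "(\<lambda>x. \<chi> i. f x i) differentiable (at x)"
proof -
  have "linear (axis i :: 'b \<Rightarrow> 'b^'i)" for i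
    by (simp add: linear_iff axis_def vec_eq_iff)
  moreover have "(\<chi> i. f x i) = (\<Sum>i\<in>UNIV. axis i (f x i))" for x
    by (simp add: vec_eq_iff axis_def)
  ultimately show ?thesis
    using differentiable_linear_compose[OF assms] by (simp only:) (intro differentiable_sum, auto)
qed

lemma component_homogeneous: "component d p \<in> homogeneous d"
  using decomposes_component[of p] by (simp add: decomposes_def)

text \<open>Indexing up to the degree lets each component be weighted by a power of \<open>t\<close>
  with exponent \<open>fm_degree p - d\<close>.\<close>

lemma sum_components: "p = (\<Sum>d\<le>fm_degree p. component d p)"
proof -
  have fin: "finite {d. component d p \<noteq> 0}" and p: "p = (\<Sum>d | component d p \<noteq> 0. component d p)"
    using decomposes_component[of p] by (simp_all add: decomposes_def)
  have "(\<Sum>d | component d p \<noteq> 0. component d p) = (\<Sum>d\<le>fm_degree p. component d p)"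
    by (rule sum.mono_neutral_left) (auto simp: fm_degree_def intro: Max_ge[OF fin])
  with p show ?thesis by simp
qed

text \<open>A real matrix with symmetric part \<open>S\<close> and antisymmetric part \<open>A\<close> encodes the Hermitian
  matrix \<open>S + \<i> A\<close>.\<close>

definition herm_of_real :: "real^'n^'n \<Rightarrow> complex^'n^'n"
  where "herm_of_real M = (\<chi> i j. Complex ((M $ i $ j + M $ j $ i) / 2) ((M $ i $ j - M $ j $ i) / 2))"

definition real_of_herm :: "complex^'n^'n \<Rightarrow> real^'n^'n"
  where "real_of_herm H = (\<chi> i j. Re (H $ i $ j) + Im (H $ i $ j))"

lemma hermitian_herm_of_real: "hermitian (herm_of_real M)"
  by (simp add: hermitian_def ctranspose_def herm_of_real_def vec_eq_iff complex_eq_iff field_simps)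

lemma real_of_herm_of_real: "real_of_herm (herm_of_real M) = M"
  by (simp add: real_of_herm_def herm_of_real_def vec_eq_iff field_simps)

lemma herm_of_real_of_herm:
  assumes "hermitian H"
  shows "herm_of_real (real_of_herm H) = H"
proof -
  have H: "H $ j $ i = cnj (H $ i $ j)" for i j
    using assms by (metis (no_types, lifting) ctranspose_def hermitian_def vec_lambda_beta)
  have HRI: "Re (H $ j $ i) = Re (H $ i $ j)" "Im (H $ j $ i) = - Im (H $ i $ j)" for i j
    by (subst H, simp)+
  have "herm_of_real (real_of_herm H) $ i $ j = H $ i $ j" for i j
    using HRI[of j i] by (simp add: herm_of_real_def real_of_herm_def complex_eq_iff)
  then show ?thesis
    by (simp add: vec_eq_iff)
qed

lemma linear_herm_of_real: "linear herm_of_real"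
  by (simp add: linear_iff herm_of_real_def vec_eq_iff complex_eq_iff field_simps)

lemma linear_real_of_herm: "linear real_of_herm"
  by (simp add: linear_iff real_of_herm_def vec_eq_iff algebra_simps)

section \<open>Common zeros by deformation to the leading forms\<close>

theorem theorem5:
  fixes p :: "'k::finite \<Rightarrow> ('n::finite, 'k) fmpoly"
  assumes "\<And>i. self_adjoint (p i)"
    and "\<And>i. p i \<noteq> 0"
    and "\<And>i. odd (fm_degree (p i))"
    and "nondegenerate (\<lambda>i. leading_form (p i))"
  shows "\<exists>X :: 'k \<Rightarrow> complex^'n^'n. (\<forall>i. hermitian (X i)) \<and> (\<forall>i. eval X (p i) = 0)"
proof (rule ccontr)
  assume no_zero: "\<not> ?thesis"
  \<comment> \<open>Encoding Hermitian tuples by real ones turns evaluation into a self-map of one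
    Euclidean space, as the degree argument demands.\<close>
  define X :: "(real^'n^'n)^'k \<Rightarrow> 'k \<Rightarrow> complex^'n^'n" where "X v i = herm_of_real (v $ i)" for v i
  \<comment> \<open>No exponent is truncated, as \<open>d\<close> is at most the degree. The sum
    stays continuous at \<open>t = 0\<close>, where \<open>0 ^ 0 = 1\<close> singles out the leading
    form.\<close>
  define h :: "real \<Rightarrow> (real^'n^'n)^'k \<Rightarrow> (real^'n^'n)^'k"
    where "h t v = (\<chi> i. \<Sum>d\<le>fm_degree (p i).
      t ^ (fm_degree (p i) - d) *\<^sub>R real_of_herm (eval (X v) (component d (p i))))" for t v
  interpret H: linear herm_of_real by (rule linear_herm_of_real)
  interpret R: linear real_of_herm by (rule linear_real_of_herm)
  have X_herm: "hermitian (X v i)" for v i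
    by (simp add: X_def hermitian_herm_of_real)
  have X_scale: "X (c *\<^sub>R v) = (\<lambda>i. c *\<^sub>R X v i)" for c v
    by (simp add: X_def fun_eq_iff H.scale)
  \<comment> \<open>On all matrices \<open>real_of_herm\<close> is not injective: an entry
    \<open>1 - \<i>\<close> goes to \<open>0\<close>. Self-adjointness is what turns zeros of
    \<open>h\<close> into zeros of the evaluated elements.\<close>
  have R_eq_0: "real_of_herm A = 0 \<longleftrightarrow> A = 0" if "hermitian A" for A
    using herm_of_real_of_herm[OF that] H.zero R.zero by metis
  have h1: "h 1 v $ i = real_of_herm (eval (X v) (p i))" for v i
    using eval_sum[of "X v" "\<lambda>d. component d (p i)" "{..fm_degree (p i)}"]
    by (simp add: h_def R.sum flip: sum_components)
  have h0: "h 0 v $ i = real_of_herm (eval (X v) (leading_form (p i)))" for v i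
  proof -
    have "h 0 v $ i = (\<Sum>d\<le>fm_degree (p i).
        if d = fm_degree (p i) then real_of_herm (eval (X v) (component d (p i))) else 0)"
      unfolding h_def vec_lambda_beta by (rule sum.cong) auto
    then show ?thesis by (simp add: leading_form_def)
  qed
  \<comment> \<open>For positive \<open>t\<close> the weights split as a common factor times
    \<open>(1 / t) ^ d\<close>, which homogeneity absorbs into the argument; a zero of
    \<open>h t\<close> is thus a rescaled zero of \<open>h 1\<close>.\<close>
  have ht: "h t v $ i = t ^ fm_degree (p i) *\<^sub>R h 1 ((1 / t) *\<^sub>R v) $ i" if "t > 0" for t v i
  proof -
    have "t ^ (fm_degree (p i) - d) = t ^ fm_degree (p i) * (1 / t) ^ d" if "d \<le> fm_degree (p i)" for d
      using \<open>t > 0\<close> that by (simp add: power_diff power_one_over)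
    then show ?thesis
      unfolding h_def vec_lambda_beta scaleR_sum_right X_scale
      by (intro sum.cong) (simp_all add: eval_scaleR_homogeneous[OF component_homogeneous] R.scale)
  qed
  have h1_nz: "h 1 v \<noteq> 0" for v
  proof
    assume "h 1 v = 0"
    then have "eval (X v) (p i) = 0" for i
      using h1[of v i] R_eq_0[OF hermitian_eval[OF X_herm assms(1)]] by simp
    with X_herm no_zero show False by blast
  qed
  have h0_nz: "h 0 v \<noteq> 0" if "v \<noteq> 0" for v
  proof
    assume "h 0 v = 0"
    then have "eval (X v) (leading_form (p i)) = 0" for i
      using h0[of v i] R_eq_0[OF hermitian_eval[OF X_herm self_adjoint_leading_form[OF assms(1)]]] by simp
    then have "X v i = 0" for i
      using assms(4) X_herm unfolding nondegenerate_def by blast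
    then have "v $ i = 0" for i
      using real_of_herm_of_real[of "v $ i"] by (simp add: X_def R.zero)
    with that show False by (simp add: vec_eq_iff)
  qed
  have h_nz: "h t v \<noteq> 0" if "0 \<le> t" "v \<noteq> 0" for t v
  proof (cases "t = 0")
    case False
    with that have t: "t > 0" by simp
    obtain i where "h 1 ((1 / t) *\<^sub>R v) $ i \<noteq> 0"
      using h1_nz[of "(1 / t) *\<^sub>R v"] by (auto simp: vec_eq_iff)
    then have "h t v $ i \<noteq> 0" using t ht[OF t, of v i] by simp
    then show ?thesis by auto
  qed (use h0_nz that in simp)
  have X_cont: "continuous_on S (\<lambda>z. X (f z) i)" if "continuous_on S f" for S i and f :: "'z::euclidean_space \<Rightarrow> _"
    unfolding X_def by (intro linear_continuous_on_compose[OF _ linear_herm_of_real] continuous_on_component that)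
  have h_cont: "continuous_on S (\<lambda>z. h (s z) (f z))" if "continuous_on S s" "continuous_on S f"
    for S s and f :: "'z::euclidean_space \<Rightarrow> _"
    unfolding h_def
    by (intro continuous_on_vec_lambda continuous_on_sum continuous_on_scaleR continuous_on_power that
      linear_continuous_on_compose[OF _ linear_real_of_herm] continuous_on_eval X_cont)
  have "homotopic_with_canon (\<lambda>_. True) (sphere 0 1) (- {0}) (h 0) (h 1)"
    unfolding homotopic_with_def
  proof (intro exI[of _ "\<lambda>z. h (fst z) (snd z)"] conjI)
    have "continuous_on ({0..1} \<times> sphere 0 1) (\<lambda>z. h (fst z) (snd z))"
      by (intro h_cont continuous_on_fst continuous_on_snd continuous_on_id)
    moreover have "h (fst z) (snd z) \<noteq> 0" if "z \<in> {0..1} \<times> sphere 0 1" for z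
      using that by (intro h_nz) auto
    ultimately show "continuous_map (prod_topology (top_of_set {0..1}) (top_of_set (sphere 0 1)))
        (top_of_set (- {0})) (\<lambda>z. h (fst z) (snd z))"
      by auto
  qed auto
  moreover
  \<comment> \<open>As \<open>h 1\<close> has no zero at all, its restriction to the sphere factors
    through the contractible whole space.\<close>
  obtain a where "homotopic_with_canon (\<lambda>_. True) (sphere 0 1) (- {0}) (h 1 \<circ> id) (\<lambda>_. a)"
    by (rule nullhomotopic_through_contractible[of "sphere 0 1" id UNIV "h 1" "- {0}"])
      (use h1_nz in \<open>auto intro: h_cont continuous_intros\<close>)
  ultimately have "homotopic_with_canon (\<lambda>_. True) (sphere 0 1) (- {0}) (h 0) (\<lambda>_. a)"
    by (auto intro: homotopic_with_trans)
  moreover have "h 0 (- v) = - h 0 v" for v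
  proof -
    have "h 0 ((-1) *\<^sub>R v) $ i = - h 0 v $ i" for i
      unfolding h0 X_scale eval_scaleR_homogeneous[OF leading_form_homogeneous]
      using assms(3)[of i] by (simp add: R.scale R.neg)
    then show ?thesis by (simp add: vec_eq_iff)
  qed
  moreover have "h 0 differentiable_on - {0}"
  proof -
    have "linear (\<lambda>v :: (real^'n^'n)^'k. v $ i)" for i by (simp add: linear_iff)
    then have "(\<lambda>v. X v i) differentiable (at v)" for v i
      unfolding X_def
      by (intro differentiable_linear_compose[OF _ linear_herm_of_real] linear_imp_differentiable)
    then have "(\<lambda>v. \<chi> i. real_of_herm (eval (X v) (leading_form (p i)))) differentiable (at v)" for v
      by (intro differentiable_vec_lambda differentiable_linear_compose[OF _ linear_real_of_herm]
        differentiable_eval)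
    moreover have "h 0 = (\<lambda>v. \<chi> i. real_of_herm (eval (X v) (leading_form (p i))))"
      by (simp add: fun_eq_iff vec_eq_iff h0)
    ultimately show ?thesis
      by (simp add: differentiable_at_withinI differentiable_on_def)
  qed
  ultimately show False
    using odd_map_not_nullhomotopic h0_nz by blast
qed

end
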